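(* Let $n\ge 1$ and let $f$ be a complex-valued function on $\mathbb{R}$ such that $f,f',\dots,f^{(n)}$ exist and are continuous on $\mathbb{R}$, except possibly at $0$, and such that $f,f',\dots,f^{(n-1)}$ are of exponential order $a$. Assume that the one-sided limits $f^{(k)}(0+)$ and $f^{(k)}(0-)$ exist for $0\le k\le n-1$. Then for every $s=x+iy$ with $x>a$ and $y\in\mathbb{R}$, $$\mathcal{SL}(f^{(n)}(t))(s)=\mathcal{L}\bigl(f^{(n)}(t)\bigr)(s)+\mathcal{L}\bigl(f^{(n)}(-t)\bigr)(\overline{s}),$$ where $$\mathcal{L}\bigl(f^{(n)}(t)\bigr)(s)=s^n\mathcal{L}(f(t))(s)-s^{n-1}f(0+)-s^{n-2}f'(0+)-\cdots-f^{(n-1)}(0+)$$ and $$\mathcal{L}\bigl(f^{(n)}(-t)\bigr)(\overline{s})=(-\overline{s})^n\mathcal{L}(f(-t))(\overline{s})+(-\overline{s})^{n-1}f(0-)+(-\overline{s})^{n-2}f'(0-)+\cdots+f^{(n-1)}(0-).$$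
   Context: A function $h$ on $\mathbb{R}$ (possibly undefined at $0$) is of exponential order $a$ (where $a>0$) if there is a constant $M>0$ such that $|h(t)|\le Me^{a|t|}$ for all $t$ in its domain. The Laplace transform of a function $h$ on $(0,\infty)$ is $\mathcal{L}(h(t))(s)=\int_0^\infty e^{-st}h(t)\,dt$; thus $\mathcal{L}(h(-t))(\overline{s})=\int_0^\infty e^{-\overline{s}t}h(-t)\,dt$, and $f^{(n)}(-t)$ means the $n$-th derivative $f^{(n)}$ evaluated at $-t$. For $s=x+iy$, the symmetric Laplace transform (with equal parameters $x_1=x_2=x$) is $$\mathcal{SL}(h)(s)=\int_0^\infty h(t)e^{-st}\,dt+\int_{-\infty}^0 h(t)e^{\overline{s}t}\,dt.$$ All integrals are improper integrals, at infinity and, where needed, at $0$: $\int_0^\infty=\lim_{\varepsilon\to0+,\,R\to\infty}\int_\varepsilon^R$ and $\int_{-\infty}^0=\lim_{\varepsilon\to0+,\,R\to\infty}\int_{-R}^{-\varepsilon}$. $f^{(k)}(0+)$ and $f^{(k)}(0-)$ denote the right and left limits of $f^{(k)}$ at $0$, with $f^{(0)}=f$. *)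

theory Defs
  imports "HOL-Analysis.Analysis"
begin

text \<open>
  A function on the real line that may be undefined at 0 is modelled by a total function
  whose value at 0 is ignored: no definition below depends on that value.
\<close>

definition exponential_order :: "real \<Rightarrow> (real \<Rightarrow> complex) \<Rightarrow> bool" where
  "exponential_order a h \<longleftrightarrow> (\<exists>M>0. \<forall>t. t \<noteq> 0 \<longrightarrow> cmod (h t) \<le> M * exp (a * \<bar>t\<bar>))"

text \<open>
  The value of \<open>nth_derivative k f\<close> at \<open>t\<close> is meaningful only where the iterated derivatives
  exist. At \<open>t \<noteq> 0\<close> it depends only on \<open>f\<close> near \<open>t\<close>, hence not on the value of \<open>f\<close> at 0.
\<close>

definition nth_derivative :: "nat \<Rightarrow> (real \<Rightarrow> complex) \<Rightarrow> real \<Rightarrow> complex" where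
  "nth_derivative k f = ((\<lambda>g t. vector_derivative g (at t)) ^^ k) f"

text \<open>
  Improper integrals over \<open>(0, \<infinity>)\<close> and \<open>(-\<infinity>, 0)\<close> as joint limits \<open>\<epsilon> \<rightarrow> 0+\<close>, \<open>R \<rightarrow> \<infinity>\<close>;
  absolute convergence is not required. The values are meaningful only under the
  corresponding convergence predicate.
\<close>

definition improper_integral_pos :: "(real \<Rightarrow> complex) \<Rightarrow> complex" where
  "improper_integral_pos h =
     Lim (at_right 0 \<times>\<^sub>F at_top) (\<lambda>(\<epsilon>, R). integral {\<epsilon>..R} h)"

definition improper_convergent_pos :: "(real \<Rightarrow> complex) \<Rightarrow> bool" where
  "improper_convergent_pos h \<longleftrightarrow>
     (\<forall>\<epsilon> R. 0 < \<epsilon> \<and> \<epsilon> < R \<longrightarrow> h integrable_on {\<epsilon>..R}) \<and>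
     (\<exists>I. ((\<lambda>(\<epsilon>, R). integral {\<epsilon>..R} h) \<longlongrightarrow> I) (at_right 0 \<times>\<^sub>F at_top))"

definition improper_integral_neg :: "(real \<Rightarrow> complex) \<Rightarrow> complex" where
  "improper_integral_neg h =
     Lim (at_right 0 \<times>\<^sub>F at_top) (\<lambda>(\<epsilon>, R). integral {-R..-\<epsilon>} h)"

definition improper_convergent_neg :: "(real \<Rightarrow> complex) \<Rightarrow> bool" where
  "improper_convergent_neg h \<longleftrightarrow>
     (\<forall>\<epsilon> R. 0 < \<epsilon> \<and> \<epsilon> < R \<longrightarrow> h integrable_on {-R..-\<epsilon>}) \<and>
     (\<exists>I. ((\<lambda>(\<epsilon>, R). integral {-R..-\<epsilon>} h) \<longlongrightarrow> I) (at_right 0 \<times>\<^sub>F at_top))"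

definition laplace :: "(real \<Rightarrow> complex) \<Rightarrow> complex \<Rightarrow> complex" where
  "laplace h s = improper_integral_pos (\<lambda>t. exp (- s * of_real t) * h t)"

definition laplace_convergent :: "(real \<Rightarrow> complex) \<Rightarrow> complex \<Rightarrow> bool" where
  "laplace_convergent h s \<longleftrightarrow> improper_convergent_pos (\<lambda>t. exp (- s * of_real t) * h t)"

definition symmetric_laplace :: "(real \<Rightarrow> complex) \<Rightarrow> complex \<Rightarrow> complex" where
  "symmetric_laplace h s =
     improper_integral_pos (\<lambda>t. h t * exp (- s * of_real t)) +
     improper_integral_neg (\<lambda>t. h t * exp (cnj s * of_real t))"

definition symmetric_laplace_convergent :: "(real \<Rightarrow> complex) \<Rightarrow> complex \<Rightarrow> bool" where
  "symmetric_laplace_convergent h s \<longleftrightarrow>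
     improper_convergent_pos (\<lambda>t. h t * exp (- s * of_real t)) \<and>
     improper_convergent_neg (\<lambda>t. h t * exp (cnj s * of_real t))"

end

theory Submission
  imports Defs
begin

text \<open>
  Integrating \<open>(exp (- s t) g t)' = exp (- s t) g' t - s exp (- s t) g t\<close> over \<open>[\<epsilon>, R]\<close> gives
  \<open>L g' = s L g - g(0+)\<close>: the boundary term at \<open>R\<close> vanishes since \<open>g\<close> is of exponential order
  \<open>a < Re s\<close>. The same bound makes \<open>L f\<close> absolutely convergent, while the convergence of the
  transform of each derivative is inherited from that of its predecessor. Both half-lines are
  treated at once by working with \<open>f\<^sup>(\<^sup>k\<^sup>) (\<sigma> t)\<close>, \<open>\<sigma> = \<plusminus>1\<close>, on \<open>t > 0\<close>.
\<close>

section \<open>Improper integrals and Laplace transforms as relations; reflection of the negative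
  half-line\<close>

text \<open>\<open>Lim\<close> has a meaningful value only if the limit exists. A relation keeps
  convergence and value together, so that one induction can carry both.\<close>

definition has_improper_integral_pos :: "(real \<Rightarrow> complex) \<Rightarrow> complex \<Rightarrow> bool" where
  "has_improper_integral_pos h I \<longleftrightarrow>
     (\<forall>\<epsilon> R. 0 < \<epsilon> \<and> \<epsilon> < R \<longrightarrow> h integrable_on {\<epsilon>..R}) \<and>
     ((\<lambda>(\<epsilon>, R). integral {\<epsilon>..R} h) \<longlongrightarrow> I) (at_right 0 \<times>\<^sub>F at_top)"

definition has_laplace :: "(real \<Rightarrow> complex) \<Rightarrow> complex \<Rightarrow> complex \<Rightarrow> bool" where
  "has_laplace h s L \<longleftrightarrow> has_improper_integral_pos (\<lambda>t. exp (- s * of_real t) * h t) L"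

lemma improper_convergent_pos_iff:
  "improper_convergent_pos h \<longleftrightarrow> (\<exists>I. has_improper_integral_pos h I)"
  unfolding improper_convergent_pos_def has_improper_integral_pos_def by blast

text \<open>Uniqueness of the limit rests on the product filter being proper: neither
  \<open>at_right 0\<close> nor \<open>at_top\<close> is \<open>bot\<close>.\<close>

lemma improper_integral_pos_eq:
  assumes "has_improper_integral_pos h I"
  shows "improper_integral_pos h = I"
  using assms unfolding improper_integral_pos_def has_improper_integral_pos_def
  by (intro tendsto_Lim) (auto simp: prod_filter_eq_bot)

text \<open>The reflection of t to -t carries \<open>{-R..-\<epsilon>}\<close> onto
  \<open>{\<epsilon>..R}\<close> and leaves the pair of parameters alone, so the limit is taken
  along the same filter.\<close>

lemma improper_convergent_neg_reflect:
  "improper_convergent_neg h \<longleftrightarrow> improper_convergent_pos (\<lambda>t. h (- t))"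
proof -
  have "h integrable_on {-R..-\<epsilon>} \<longleftrightarrow> (\<lambda>t. h (- t)) integrable_on {\<epsilon>..R}" for \<epsilon> R :: real
    using Henstock_Kurzweil_Integration.integrable_reflect_real[of "\<lambda>t. h (- t)" R \<epsilon>] by simp
  moreover have "integral {-R..-\<epsilon>} h = integral {\<epsilon>..R} (\<lambda>t. h (- t))" for \<epsilon> R :: real
    using Henstock_Kurzweil_Integration.integral_reflect_real[of R \<epsilon> "\<lambda>t. h (- t)"] by simp
  ultimately show ?thesis
    unfolding improper_convergent_neg_def improper_convergent_pos_def by simp
qed

lemma improper_integral_neg_reflect:
  "improper_integral_neg h = improper_integral_pos (\<lambda>t. h (- t))"
proof -
  have "integral {-R..-\<epsilon>} h = integral {\<epsilon>..R} (\<lambda>t. h (- t))" for \<epsilon> R :: real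
    using Henstock_Kurzweil_Integration.integral_reflect_real[of R \<epsilon> "\<lambda>t. h (- t)"] by simp
  then show ?thesis
    unfolding improper_integral_neg_def improper_integral_pos_def by simp
qed

lemma has_laplace_convergent: "has_laplace h s L \<Longrightarrow> laplace_convergent h s"
  unfolding has_laplace_def laplace_convergent_def improper_convergent_pos_iff by blast

lemma has_laplace_eq: "has_laplace h s L \<Longrightarrow> laplace h s = L"
  unfolding has_laplace_def laplace_def by (rule improper_integral_pos_eq)

text \<open>At -t the kernel \<open>exp (cnj s * of_real t)\<close> becomes the Laplace kernel with
  parameter \<open>cnj s\<close>.\<close>

lemma symmetric_laplace_convergent_iff:
  "symmetric_laplace_convergent h s \<longleftrightarrow>
     laplace_convergent h s \<and> laplace_convergent (\<lambda>t. h (- t)) (cnj s)"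
  unfolding symmetric_laplace_convergent_def laplace_convergent_def
  by (simp add: improper_convergent_neg_reflect mult.commute)

lemma symmetric_laplace_eq:
  "symmetric_laplace h s = laplace h s + laplace (\<lambda>t. h (- t)) (cnj s)"
  unfolding symmetric_laplace_def laplace_def
  by (simp add: improper_integral_neg_reflect mult.commute)

section \<open>Existence of the transform by absolute convergence\<close>

text \<open>The cut point 1 is arbitrary. It separates the two endpoints, which orders them and
  allows an integral to be split at 1.\<close>

lemma eventually_at_right_0_times_at_top:
  "\<forall>\<^sub>F p in at_right (0 :: real) \<times>\<^sub>F at_top. (0 < fst p \<and> fst p < 1) \<and> 1 < (snd p :: real)"
  by (intro eventually_prodI eventually_at_rightI[of 0 1] eventually_gt_at_top) auto

text \<open>After splitting at 1 each endpoint occurs in only one summand, so the joint limit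
  reduces to two limits in one variable, both instances of continuity of the Lebesgue integral in
  its endpoint.\<close>

lemma has_improper_integral_pos_absolutely_integrable:
  assumes "h absolutely_integrable_on {0<..}"
  shows "has_improper_integral_pos h (integral {0<..1} h + integral {1..} h)"
proof -
  have abs_sub: "h absolutely_integrable_on S" if "S \<in> sets lebesgue" "S \<subseteq> {0<..}" for S
    using set_integrable_subset[OF assms that] .
  have int: "h integrable_on {\<epsilon>..R}" if "0 < \<epsilon>" for \<epsilon> R :: real
    by (rule set_lebesgue_integral_eq_integral(1)[OF abs_sub]) (use that in auto)
  \<comment> \<open>The endpoint limits are taken for the Lebesgue integral, the definitions use the
    gauge integral; absolute integrability makes them agree.\<close>
  have lint: "(LINT x:S|lebesgue. h x) = integral S h"
    if "S \<in> sets lebesgue" "S \<subseteq> {0<..}" for S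
    using set_lebesgue_integral_eq_integral(2)[OF abs_sub[OF that]] .
  have "((\<lambda>\<epsilon>. LINT x:{\<epsilon>..1}|lebesgue. h x) \<longlongrightarrow> (LINT x:{0<..1}|lebesgue. h x)) (at_right 0)"
    by (rule tendsto_set_lebesgue_integral_at_right) (auto intro: abs_sub)
  moreover have "\<forall>\<^sub>F \<epsilon> in at_right 0. (LINT x:{\<epsilon>..1}|lebesgue. h x) = integral {\<epsilon>..1} h"
    by (rule eventually_at_rightI[of 0 1]) (auto intro!: lint)
  ultimately have "((\<lambda>\<epsilon>. integral {\<epsilon>..1} h) \<longlongrightarrow> integral {0<..1} h) (at_right 0)"
    by (subst (asm) lint) (auto intro: Lim_transform_eventually)
  then have near_0: "((\<lambda>p. integral {fst p..1} h) \<longlongrightarrow> integral {0<..1} h) (at_right 0 \<times>\<^sub>F at_top)"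
    by (rule filterlim_compose) (rule filterlim_fst)
  have "((\<lambda>R. LINT x:{1..R}|lebesgue. h x) \<longlongrightarrow> (LINT x:{1..}|lebesgue. h x)) at_top"
    by (rule tendsto_set_lebesgue_integral_at_top) (auto intro: abs_sub)
  moreover have "(LINT x:{1..R}|lebesgue. h x) = integral {1..R} h" for R
    by (rule lint) auto
  moreover have "(LINT x:{1..}|lebesgue. h x) = integral {1..} h"
    by (rule lint) auto
  ultimately have "((\<lambda>R. integral {1..R} h) \<longlongrightarrow> integral {1..} h) at_top"
    by simp
  then have near_inf: "((\<lambda>p. integral {1..snd p} h) \<longlongrightarrow> integral {1..} h) (at_right 0 \<times>\<^sub>F at_top)"
    by (rule filterlim_compose) (rule filterlim_snd)
  from eventually_at_right_0_times_at_top have "\<forall>\<^sub>F p in at_right 0 \<times>\<^sub>F at_top.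
      integral {fst p..1} h + integral {1..snd p} h = (\<lambda>(\<epsilon>, R). integral {\<epsilon>..R} h) p"
    by eventually_elim
       (auto simp: case_prod_unfold intro!: Henstock_Kurzweil_Integration.integral_combine int)
  then show ?thesis
    unfolding has_improper_integral_pos_def
    using int tendsto_add[OF near_0 near_inf] by (auto intro: Lim_transform_eventually)
qed

text \<open>For a < \<open>Re s\<close> the right-hand side decays. It serves both as integrable
  majorant and to make the boundary term at infinity vanish.\<close>

lemma cmod_exp_mult_le:
  assumes "cmod z \<le> M * exp (a * t)"
  shows "cmod (exp (- s * of_real t) * z) \<le> M * exp (- (Re s - a) * t)"
proof -
  have "cmod (exp (- s * of_real t) * z) \<le> exp (- Re s * t) * (M * exp (a * t))"
    using assms by (simp add: norm_mult mult_left_mono)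
  also have "\<dots> = M * exp (- (Re s - a) * t)"
    by (simp add: algebra_simps flip: exp_add)
  finally show ?thesis .
qed

text \<open>Continuity supplies measurability, and the decaying exponential dominates the
  integrand.\<close>

lemma has_laplace_exists:
  assumes cont: "continuous_on {0<..} h"
    and bound: "\<And>t. t > 0 \<Longrightarrow> cmod (h t) \<le> M * exp (a * t)"
    and "Re s > a"
  shows "\<exists>L. has_laplace h s L"
proof -
  let ?h = "\<lambda>t. exp (- s * of_real t) * h t"
  let ?g = "\<lambda>t. M * exp (- (Re s - a) * t)"
  have "?h \<in> borel_measurable (lebesgue_on {0<..})"
    by (intro continuous_imp_measurable_on_sets_lebesgue continuous_intros cont) auto
  moreover have "?g integrable_on {0<..}"
  proof -
    have "(\<lambda>t. exp (- (Re s - a) * t)) integrable_on {0..}"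
      using \<open>Re s > a\<close> by (intro integrable_on_exp_minus_to_infinity) simp
    \<comment> \<open>Plain gauge integrability need not pass to subsets, absolute integrability
      does; this leads from the closed to the open half-line.\<close>
    then have "(\<lambda>t. exp (- (Re s - a) * t)) absolutely_integrable_on {0..}"
      by (intro nonnegative_absolutely_integrable_1) auto
    then have "(\<lambda>t. exp (- (Re s - a) * t)) absolutely_integrable_on {0<..}"
      by (rule set_integrable_subset) auto
    then show ?thesis
      by (intro integrable_on_mult_right set_lebesgue_integral_eq_integral(1))
  qed
  ultimately have "?h absolutely_integrable_on {0<..}"
    by (elim measurable_bounded_by_integrable_imp_absolutely_integrable)
       (use cmod_exp_mult_le[OF bound] in auto)
  then show ?thesis
    unfolding has_laplace_def by (blast intro: has_improper_integral_pos_absolutely_integrable)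
qed

section \<open>Transforms of derivatives\<close>

text \<open>Convergence for \<open>g'\<close> is part of the conclusion: integration by parts
  expresses its truncated integrals through terms that converge. This suits the derivative of order
  n, whose growth is not controlled.\<close>

lemma has_laplace_derivative:
  assumes L: "has_laplace g s L"
    and deriv: "\<And>t. t > 0 \<Longrightarrow> (g has_vector_derivative g' t) (at t)"
    and bound: "\<And>t. t > 0 \<Longrightarrow> cmod (g t) \<le> M * exp (a * t)"
    and lim: "(g \<longlongrightarrow> c) (at_right 0)"
    and "Re s > a"
  shows "has_laplace g' s (s * L - c)"
proof -
  define E where "E t = exp (- s * of_real t)" for t :: real
  have E_deriv: "(E has_vector_derivative - s * E t) (at t)" for t
    unfolding E_def by (auto intro!: derivative_eq_intros has_vector_derivative_real_field)
  have E_lim: "(E \<longlongrightarrow> 1) (at_right 0)"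
    unfolding E_def by (auto intro!: tendsto_eq_intros)
  have Eg_int: "(\<lambda>t. E t * g t) integrable_on {\<epsilon>..R}" if "0 < \<epsilon>" "\<epsilon> < R" for \<epsilon> R
    using L that unfolding has_laplace_def has_improper_integral_pos_def E_def by blast
  have parts: "((\<lambda>t. E t * g' t) has_integral
      E R * g R - E \<epsilon> * g \<epsilon> + s * integral {\<epsilon>..R} (\<lambda>t. E t * g t)) {\<epsilon>..R}"
    if "0 < \<epsilon>" "\<epsilon> < R" for \<epsilon> R
  proof -
    have "((\<lambda>t. E t * g t) has_vector_derivative E t * g' t - s * (E t * g t))
        (at t within {\<epsilon>..R})" if "t \<in> {\<epsilon>..R}" for t
      using has_vector_derivative_mult[OF E_deriv deriv, of t] that \<open>0 < \<epsilon>\<close>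
      by (auto intro!: has_vector_derivative_at_within simp: algebra_simps)
    \<comment> \<open>The fundamental theorem makes the whole derivative gauge integrable; adding
      back the integrable term \<open>s * (E t * g t)\<close> isolates
      \<open>E t * g' t\<close>.\<close>
    then have "((\<lambda>t. E t * g' t - s * (E t * g t)) has_integral E R * g R - E \<epsilon> * g \<epsilon>) {\<epsilon>..R}"
      using that by (intro fundamental_theorem_of_calculus) auto
    from has_integral_add[OF this has_integral_mult_right[OF integrable_integral[OF Eg_int[OF that]], of s]]
    show ?thesis by simp
  qed
  have "((\<lambda>t. M * exp (- (Re s - a) * t)) \<longlongrightarrow> 0) at_top"
  proof -
    have "((\<lambda>t. exp (- (Re s - a) * t)) \<longlongrightarrow> 0) at_top"
      using \<open>Re s > a\<close>
      by (intro filterlim_compose[OF exp_at_bot] filterlim_tendsto_neg_mult_at_bot[OF tendsto_const]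
          filterlim_ident) auto
    then show ?thesis by (rule tendsto_mult_right_zero)
  qed
  moreover have "\<forall>\<^sub>F t in at_top. cmod (E t * g t) \<le> M * exp (- (Re s - a) * t)"
    using eventually_gt_at_top[of 0] unfolding E_def
    by eventually_elim (intro cmod_exp_mult_le bound)
  ultimately have "((\<lambda>t. E t * g t) \<longlongrightarrow> 0) at_top"
    by (rule Lim_null_comparison[rotated])
  then have at_inf: "((\<lambda>p. E (snd p) * g (snd p)) \<longlongrightarrow> 0) (at_right 0 \<times>\<^sub>F at_top)"
    by (rule filterlim_compose) (rule filterlim_snd)
  have "((\<lambda>t. E t * g t) \<longlongrightarrow> c) (at_right 0)"
    using tendsto_mult[OF E_lim lim] by simp
  then have at_0: "((\<lambda>p. E (fst p) * g (fst p)) \<longlongrightarrow> c) (at_right 0 \<times>\<^sub>F at_top)"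
    by (rule filterlim_compose) (rule filterlim_fst)
  have "((\<lambda>p. integral {fst p..snd p} (\<lambda>t. E t * g t)) \<longlongrightarrow> L) (at_right 0 \<times>\<^sub>F at_top)"
    using L unfolding has_laplace_def has_improper_integral_pos_def E_def
    by (simp add: case_prod_unfold)
  then have "((\<lambda>p. E (snd p) * g (snd p) - E (fst p) * g (fst p)
      + s * integral {fst p..snd p} (\<lambda>t. E t * g t)) \<longlongrightarrow> 0 - c + s * L) (at_right 0 \<times>\<^sub>F at_top)"
    by (intro tendsto_intros at_inf at_0)
  moreover from eventually_at_right_0_times_at_top have "\<forall>\<^sub>F p in at_right 0 \<times>\<^sub>F at_top.
      E (snd p) * g (snd p) - E (fst p) * g (fst p) + s * integral {fst p..snd p} (\<lambda>t. E t * g t)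
      = (\<lambda>(\<epsilon>, R). integral {\<epsilon>..R} (\<lambda>t. E t * g' t)) p"
    by eventually_elim (auto simp: case_prod_unfold intro!: integral_unique[symmetric] parts)
  ultimately have "((\<lambda>(\<epsilon>, R). integral {\<epsilon>..R} (\<lambda>t. E t * g' t)) \<longlongrightarrow> s * L - c)
      (at_right 0 \<times>\<^sub>F at_top)"
    by (auto intro: Lim_transform_eventually)
  moreover have "(\<lambda>t. E t * g' t) integrable_on {\<epsilon>..R}" if "0 < \<epsilon>" "\<epsilon> < R" for \<epsilon> R
    using parts[OF that] by blast
  ultimately show ?thesis
    unfolding has_laplace_def has_improper_integral_pos_def E_def by blast
qed

lemma has_laplace_mult_left:
  assumes "has_laplace h s L"
  shows "has_laplace (\<lambda>t. c * h t) s (c * L)"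
proof -
  have eq: "(\<lambda>t. exp (- s * of_real t) * (c * h t)) = (\<lambda>t. c * (exp (- s * of_real t) * h t))"
    by (simp add: mult_ac)
  show ?thesis
    using assms unfolding has_laplace_def has_improper_integral_pos_def eq
    by (auto simp: case_prod_unfold intro!: integrable_on_mult_right tendsto_mult_left)
qed

text \<open>The factor \<sigma> in \<open>deriv\<close> comes from the chain rule for t mapped to
  \<sigma> t. As \<sigma> is its own inverse, multiplying by it turns the rule for one derivative
  into the recursion \<open>\<sigma> * (s * Ln - c n)\<close> for the next value.\<close>

lemma has_laplace_iterated_derivative:
  fixes u :: "nat \<Rightarrow> real \<Rightarrow> complex" and \<sigma> :: complex
  assumes "\<sigma> * \<sigma> = 1"
    and L: "has_laplace (u 0) s L"
    and deriv: "\<And>k t. k < n \<Longrightarrow> t > 0 \<Longrightarrow> (u k has_vector_derivative \<sigma> * u (Suc k) t) (at t)"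
    and bound: "\<And>k. k < n \<Longrightarrow> \<exists>M. \<forall>t>0. cmod (u k t) \<le> M * exp (a * t)"
    and lim: "\<And>k. k < n \<Longrightarrow> (u k \<longlongrightarrow> c k) (at_right 0)"
    and "Re s > a"
  shows "has_laplace (u n) s ((\<sigma> * s) ^ n * L - \<sigma> * (\<Sum>k<n. (\<sigma> * s) ^ (n - 1 - k) * c k))"
  using deriv bound lim
proof (induction n)
  case 0
  then show ?case using L by simp
next
  case (Suc n)
  define Ln where "Ln = (\<sigma> * s) ^ n * L - \<sigma> * (\<Sum>k<n. (\<sigma> * s) ^ (n - 1 - k) * c k)"
  obtain M where "\<And>t. t > 0 \<Longrightarrow> cmod (u n t) \<le> M * exp (a * t)"
    using Suc.prems(2)[of n] by auto
  moreover have "has_laplace (u n) s Ln"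
    unfolding Ln_def by (rule Suc.IH) (use Suc.prems in auto)
  ultimately have "has_laplace (\<lambda>t. \<sigma> * u (Suc n) t) s (s * Ln - c n)"
    using Suc.prems(1,3)[of n] \<open>Re s > a\<close> by (auto intro: has_laplace_derivative)
  then have "has_laplace (\<lambda>t. \<sigma> * (\<sigma> * u (Suc n) t)) s (\<sigma> * (s * Ln - c n))"
    by (rule has_laplace_mult_left)
  moreover have "(\<lambda>t. \<sigma> * (\<sigma> * u (Suc n) t)) = u (Suc n)"
    using \<open>\<sigma> * \<sigma> = 1\<close> by (simp add: mult.assoc[symmetric])
  moreover have "\<sigma> * (s * Ln - c n)
      = (\<sigma> * s) ^ Suc n * L - \<sigma> * (\<Sum>k<Suc n. (\<sigma> * s) ^ (Suc n - 1 - k) * c k)"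
  proof -
    \<comment> \<open>Each old boundary term gains a factor \<open>\<sigma> * s\<close>; the new
      one, k = n, enters with exponent 0. Truncated subtraction requires k < n here.\<close>
    have "(\<sigma> * s) ^ (n - k) * c k = \<sigma> * s * ((\<sigma> * s) ^ (n - 1 - k) * c k)" if "k < n" for k
    proof -
      have "n - k = Suc (n - 1 - k)" using that by simp
      then show ?thesis by simp
    qed
    then have "(\<Sum>k<n. (\<sigma> * s) ^ (n - k) * c k)
        = \<sigma> * s * (\<Sum>k<n. (\<sigma> * s) ^ (n - 1 - k) * c k)"
      unfolding sum_distrib_left by (intro sum.cong) auto
    then have "(\<Sum>k<Suc n. (\<sigma> * s) ^ (Suc n - 1 - k) * c k)
        = \<sigma> * s * (\<Sum>k<n. (\<sigma> * s) ^ (n - 1 - k) * c k) + c n"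
      by simp
    then show ?thesis
      unfolding Ln_def by (simp add: algebra_simps)
  qed
  ultimately show ?case by simp
qed

section \<open>Iterated derivatives on both half-lines\<close>

lemma nth_derivative_0 [simp]: "nth_derivative 0 f = f"
  by (simp add: nth_derivative_def)

lemma nth_derivative_Suc:
  "nth_derivative (Suc k) f t = vector_derivative (nth_derivative k f) (at t)"
  by (simp add: nth_derivative_def)

text \<open>For t > 0 the absolute value of \<sigma> t is t, so both half-lines share one
  majorant.\<close>

lemma exponential_order_bound:
  assumes "exponential_order a h" "\<bar>\<sigma>\<bar> = 1"
  shows "\<exists>M. \<forall>t>0. cmod (h (\<sigma> * t)) \<le> M * exp (a * t)"
proof -
  obtain M where M: "\<And>t. t \<noteq> 0 \<Longrightarrow> cmod (h t) \<le> M * exp (a * \<bar>t\<bar>)"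
    using assms(1) unfolding exponential_order_def by blast
  have "cmod (h (\<sigma> * t)) \<le> M * exp (a * t)" if "t > 0" for t
    using M[of "\<sigma> * t"] that assms(2) by (auto simp: abs_mult)
  then show ?thesis by blast
qed

text \<open>The limits along \<sigma> t are right limits at 0 for \<sigma> = 1 and left limits for
  \<sigma> = -1. The value \<open>L\<close> is exported with its meaning because the formula for
  order n refers to it.\<close>

lemma has_laplace_nth_derivative:
  fixes f :: "real \<Rightarrow> complex" and \<sigma> :: real and s :: complex and c :: "nat \<Rightarrow> complex"
  assumes "n \<ge> 1" and \<sigma>: "\<bar>\<sigma>\<bar> = 1"
    and diff: "\<And>k t. k < n \<Longrightarrow> t \<noteq> 0 \<Longrightarrow> nth_derivative k f differentiable (at t)"
    and bound: "\<And>k. k < n \<Longrightarrow> exponential_order a (nth_derivative k f)"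
    and lim: "\<And>k. k < n \<Longrightarrow> ((\<lambda>t. nth_derivative k f (\<sigma> * t)) \<longlongrightarrow> c k) (at_right 0)"
    and "Re s > a"
  obtains L where "has_laplace (\<lambda>t. f (\<sigma> * t)) s L"
    and "has_laplace (\<lambda>t. nth_derivative n f (\<sigma> * t)) s
      ((\<sigma> * s) ^ n * L - \<sigma> * (\<Sum>k<n. (\<sigma> * s) ^ (n - 1 - k) * c k))"
proof -
  have deriv: "((\<lambda>t. nth_derivative k f (\<sigma> * t)) has_vector_derivative
      \<sigma> * nth_derivative (Suc k) f (\<sigma> * t)) (at t)" if "k < n" "t > 0" for k t
  proof -
    have "\<sigma> * t \<noteq> 0" using \<sigma> that by auto
    then have "(nth_derivative k f has_vector_derivative nth_derivative (Suc k) f (\<sigma> * t))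
        (at (\<sigma> * t))"
      unfolding nth_derivative_Suc using diff that by (simp flip: vector_derivative_works)
    moreover have "((*) \<sigma> has_vector_derivative \<sigma>) (at t)"
      by (auto intro!: derivative_eq_intros simp flip: has_real_derivative_iff_has_vector_derivative)
    ultimately show ?thesis
      using vector_diff_chain_at[of "(*) \<sigma>" \<sigma> t "nth_derivative k f"]
      by (simp add: o_def scaleR_conv_of_real)
  qed
  \<comment> \<open>As n \<ge> 1, the index k = 0 is admissible, which gives differentiability and
    the growth bound for f itself.\<close>
  have "continuous_on {0<..} (\<lambda>t. f (\<sigma> * t))"
    using deriv[of 0] \<open>n \<ge> 1\<close>
    by (auto intro!: continuous_at_imp_continuous_on dest: has_vector_derivative_continuous)
  moreover obtain M where "\<And>t. t > 0 \<Longrightarrow> cmod (f (\<sigma> * t)) \<le> M * exp (a * t)"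
    using exponential_order_bound[OF bound[of 0] \<sigma>] \<open>n \<ge> 1\<close> by auto
  ultimately obtain L where L: "has_laplace (\<lambda>t. f (\<sigma> * t)) s L"
    using has_laplace_exists \<open>Re s > a\<close> by blast
  have "complex_of_real \<sigma> * complex_of_real \<sigma> = 1"
    using \<sigma> by (auto simp: abs_if split: if_splits)
  then have "has_laplace (\<lambda>t. nth_derivative n f (\<sigma> * t)) s
      ((\<sigma> * s) ^ n * L - \<sigma> * (\<Sum>k<n. (\<sigma> * s) ^ (n - 1 - k) * c k))"
    by (rule has_laplace_iterated_derivative[where u = "\<lambda>k t. nth_derivative k f (\<sigma> * t)"])
       (use L deriv lim exponential_order_bound[OF bound \<sigma>] \<open>Re s > a\<close> in auto)
  with L show thesis by (rule that)
qed

theorem theorem5: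
  fixes f :: "real \<Rightarrow> complex" and n :: nat and a :: real
    and fp fm :: "nat \<Rightarrow> complex" and s :: complex
  assumes "n \<ge> 1"
    and "a > 0"
    and "\<And>k t. k < n \<Longrightarrow> t \<noteq> 0 \<Longrightarrow> nth_derivative k f differentiable (at t)"
    and "\<And>k. k \<le> n \<Longrightarrow> continuous_on (- {0}) (nth_derivative k f)"
    and "\<And>k. k < n \<Longrightarrow> exponential_order a (nth_derivative k f)"
    and "\<And>k. k < n \<Longrightarrow> (nth_derivative k f \<longlongrightarrow> fp k) (at_right 0)"
    and "\<And>k. k < n \<Longrightarrow> (nth_derivative k f \<longlongrightarrow> fm k) (at_left 0)"
    and "Re s > a"
  shows "symmetric_laplace_convergent (nth_derivative n f) s \<and>
     laplace_convergent (nth_derivative n f) s \<and>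
     laplace_convergent (\<lambda>t. nth_derivative n f (- t)) (cnj s) \<and>
     laplace_convergent f s \<and>
     laplace_convergent (\<lambda>t. f (- t)) (cnj s) \<and>
     symmetric_laplace (nth_derivative n f) s =
           laplace (nth_derivative n f) s + laplace (\<lambda>t. nth_derivative n f (- t)) (cnj s) \<and>
     laplace (nth_derivative n f) s =
           s ^ n * laplace f s - (\<Sum>k<n. s ^ (n - 1 - k) * fp k) \<and>
     laplace (\<lambda>t. nth_derivative n f (- t)) (cnj s) =
           (- cnj s) ^ n * laplace (\<lambda>t. f (- t)) (cnj s) +
           (\<Sum>k<n. (- cnj s) ^ (n - 1 - k) * fm k)"
proof -
  note A = assms
  obtain Lp where "has_laplace (\<lambda>t. f (1 * t)) s Lp"
    and "has_laplace (\<lambda>t. nth_derivative n f (1 * t)) s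
      ((of_real 1 * s) ^ n * Lp - of_real 1 * (\<Sum>k<n. (of_real 1 * s) ^ (n - 1 - k) * fp k))"
    by (rule has_laplace_nth_derivative[where \<sigma> = 1 and c = fp and s = s, OF A(1) _ A(3,5)])
       (use A(6,8) in auto)
  then have pos: "has_laplace f s Lp"
    "has_laplace (nth_derivative n f) s (s ^ n * Lp - (\<Sum>k<n. s ^ (n - 1 - k) * fp k))"
    by simp_all
  have lim_neg: "((\<lambda>t. nth_derivative k f (- 1 * t)) \<longlongrightarrow> fm k) (at_right 0)" if "k < n" for k
    \<comment> \<open>\<open>at_left 0\<close> is the image of \<open>at_right 0\<close> under
      negation.\<close>
    using A(7)[OF that] by (simp add: at_left_minus filterlim_filtermap)
  \<comment> \<open>\<open>cnj s\<close> has the same real part as s, so the bound a <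
    \<open>Re s\<close> carries over. With \<sigma> = -1 the factor -\<sigma> before the sum becomes
    1, whence the plus sign on this side.\<close>
  obtain Lm where "has_laplace (\<lambda>t. f (- 1 * t)) (cnj s) Lm"
    and "has_laplace (\<lambda>t. nth_derivative n f (- 1 * t)) (cnj s)
      ((of_real (- 1) * cnj s) ^ n * Lm
        - of_real (- 1) * (\<Sum>k<n. (of_real (- 1) * cnj s) ^ (n - 1 - k) * fm k))"
    by (rule has_laplace_nth_derivative[where \<sigma> = "- 1" and c = fm and s = "cnj s",
          OF A(1) _ A(3,5) lim_neg]) (use A(8) in auto)
  then have neg: "has_laplace (\<lambda>t. f (- t)) (cnj s) Lm"
    "has_laplace (\<lambda>t. nth_derivative n f (- t)) (cnj s)
      ((- cnj s) ^ n * Lm + (\<Sum>k<n. (- cnj s) ^ (n - 1 - k) * fm k))"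
    by simp_all
  show ?thesis
    using pos neg
    by (simp add: has_laplace_convergent has_laplace_eq symmetric_laplace_convergent_iff
        symmetric_laplace_eq)
qed

end
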